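(* Let $k\ge 2$ and let $S^k$ be the $k$-uniform sunflower hypergraph. Then the spectrum of its adjacency matrix is $$\sigma_A(S^k)=\begin{pmatrix}-1 & \frac{(k-3)+\sqrt{(k+3)(k-1)}}{2} & \frac{(k-3)-\sqrt{(k+3)(k-1)}}{2} & r_1 & r_2 & r_3\\ (k-1)(k-2) & k-2 & k-2 & 1&1&1\end{pmatrix},$$ where, for $i=1,2,3$, $$r_i=\frac23\left(-2+k+\sqrt{-2+2k+k^2}\;\cos\left(\frac{\theta+2(i-1)\pi}{3}\right)\right),\qquad \theta=\cos^{-1}\left(\frac{34-51k+21k^2-2k^3}{2\sqrt{(-2+2k+k^2)^3}}\right).$$
   Context: A hypergraph $G^*=(V,E)$ has a finite vertex set $V=\{v_1,\dots,v_N\}$ and a finite set $E$ of hyperedges, each a subset of $V$. Its adjacency matrix $A=(a_{ij})$ has $a_{ij}=|\{e\in E:\{v_i,v_j\}\subset e\}|$ for $i\ne j$ and $a_{ii}=0$. The sunflower hypergraph $S^k$ is the $k$-uniform hypergraph of order $k(k-1)+1$ with vertices $v_{0,0}$ and $v_{i,j}$ ($1\le i\le k-1$, $1\le j\le k$) and hyperedges $\{v_{i,1},v_{i,2},\dots,v_{i,k}\}$ for $1\le i\le k-1$ together with $\{v_{0,0},v_{1,1},v_{2,1},\dots,v_{k-1,1}\}$. The two-row notation for a spectrum lists eigenvalues in the first row and multiplicities in the second; it is read as a multiset (if listed values coincide, their multiplicities add, and multiplicity $0$ means the entry is absent). *)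

theory Defs
  imports Complex_Main "Jordan_Normal_Form.Char_Poly"
begin

definition hypergraph :: "'v set \<Rightarrow> 'v set set \<Rightarrow> bool" where
  "hypergraph V E \<longleftrightarrow> finite V \<and> finite E \<and> (\<forall>e\<in>E. e \<subseteq> V)"

definition uniform_hypergraph :: "nat \<Rightarrow> 'v set \<Rightarrow> 'v set set \<Rightarrow> bool" where
  "uniform_hypergraph k V E \<longleftrightarrow> hypergraph V E \<and> (\<forall>e\<in>E. card e = k)"

(* The vertex labelling v_1, ..., v_N that indexes the rows and columns is the list vs
   (with v_i = vs ! (i - 1)).  The inclusion of the pair in a hyperedge is not strict:
   for k = 2 the hypergraph is a graph and the matrix is its usual adjacency matrix. *)

definition adjacency_matrix :: "'v list \<Rightarrow> 'v set set \<Rightarrow> real mat" where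
  "adjacency_matrix vs E = mat (length vs) (length vs)
     (\<lambda>(i, j). if i = j then 0 else real (card {e \<in> E. {vs ! i, vs ! j} \<subseteq> e}))"

(* Eigenvalues with algebraic multiplicity (orders as roots of the characteristic polynomial).
   Adjacency matrices are real symmetric, so taking the roots over the reals loses nothing and
   the algebraic multiplicities are also the geometric ones. *)

definition adjacency_spectrum :: "'v list \<Rightarrow> 'v set set \<Rightarrow> real multiset" where
  "adjacency_spectrum vs E = proots (char_poly (adjacency_matrix vs E))"

(* The vertex v_{i,j} is the pair (i, j). *)

definition sunflower_vertices :: "nat \<Rightarrow> (nat \<times> nat) set" where
  "sunflower_vertices k = insert (0, 0) ({1..k - 1} \<times> {1..k})"

definition sunflower_edges :: "nat \<Rightarrow> (nat \<times> nat) set set" where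
  "sunflower_edges k =
     insert (insert (0, 0) {(i, 1) |i. i \<in> {1..k - 1}})
       {{(i, j) |j. j \<in> {1..k}} |i. i \<in> {1..k - 1}}"

lemma card_sunflower_vertices: "card (sunflower_vertices k) = k * (k - 1) + 1"
  unfolding sunflower_vertices_def by (subst card_insert_disjoint) (auto simp: mult.commute)

lemma uniform_hypergraph_sunflower:
  assumes "k \<ge> 2"
  shows "uniform_hypergraph k (sunflower_vertices k) (sunflower_edges k)"
proof -
  have central: "{(i, 1::nat) |i. i \<in> {1..k - 1}} = (\<lambda>i. (i, 1)) ` {1..k - 1}"
    by auto
  have petal: "{(i, j) |j. j \<in> {1..k}} = Pair i ` {1..k}" for i :: nat
    by auto
  have "card (insert (0, 0) ((\<lambda>i. (i, 1::nat)) ` {1..k - 1})) = Suc (card {1..k - 1})"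
    by (subst card_insert_disjoint) (auto simp: card_image inj_on_def)
  then have c1: "card (insert (0, 0) {(i, 1::nat) |i. i \<in> {1..k - 1}}) = k"
    using assms by (subst central) simp
  have c2: "card {(i, j) |j. j \<in> {1..k}} = k" for i :: nat
    by (subst petal) (simp add: card_image inj_on_def)
  have fin: "finite (sunflower_edges k)"
    unfolding sunflower_edges_def by (simp add: setcompr_eq_image)
  have sub: "\<forall>e\<in>sunflower_edges k. e \<subseteq> sunflower_vertices k"
    using assms unfolding sunflower_edges_def sunflower_vertices_def by auto
  have crd: "\<forall>e\<in>sunflower_edges k. card e = k"
    unfolding sunflower_edges_def using c1 c2 by blast
  show ?thesis
    unfolding uniform_hypergraph_def hypergraph_def
    using fin sub crd by (auto simp: sunflower_vertices_def)
qed

end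

theory Submission
  imports Defs
begin

text \<open>
  The matrix is diagonalised by an explicit eigenbasis. Call the $v_{i,1}$ inner and the $v_{i,j}$
  with $j \ge 2$ outer vertices. Differences of two outer vertices of one petal are
  eigenvectors for $-1$ and span all functions supported on the outer vertices whose sum over each
  petal vanishes. On functions constant on the outer vertices of each petal, with values $x$ at the
  centre, $y_i$ inside and $z_i$ outside, the eigenvalue equation is
  $\lambda x = \sum_i y_i$, $\lambda y_i = x + \sum_{m \ne i} y_m + (k-1) z_i$,
  $\lambda z_i = y_i + (k-2) z_i$. With $\beta = \lambda - (k-2)$ it forces $y_i = \beta z_i$. The
  functions with $\sum_i z_i = 0$ and $x = 0$ make $\lambda$ a root of a quadratic; those with all
  $z_i = 1$ have $x = \beta^2 - (k-1)$ and make $\lambda$ a root of a cubic, which Viete's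
  trigonometric formula solves with three distinct real roots.
\<close>

section \<open>Spectra from an explicit eigenbasis\<close>

text \<open>The columns of the invertible matrix \<open>P\<close> form an eigenbasis, so conjugation
  by \<open>P\<close> turns \<open>A\<close> into a diagonal matrix with the same characteristic
  polynomial.\<close>

lemma proots_char_poly_diagonalizable:
  fixes A :: "'a :: field mat"
  assumes A: "A \<in> carrier_mat n n" and P: "P \<in> carrier_mat n n" and "det P \<noteq> 0"
    and eig: "\<And>j. j < n \<Longrightarrow> A *\<^sub>v col P j = l j \<cdot>\<^sub>v col P j"
  shows "proots (char_poly A) = image_mset l (mset [0..<n])"
proof -
  define D where "D = mat n n (\<lambda>(i, j). if i = j then l j else 0)"
  have D: "D \<in> carrier_mat n n"
    by (simp add: D_def)
  obtain Q where Q: "Q \<in> carrier_mat n n" "Q * P = 1\<^sub>m n" "P * Q = 1\<^sub>m n"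
    using det_non_zero_imp_unit[OF P \<open>det P \<noteq> 0\<close>, of "()"]
    by (auto simp: Units_def ring_mat_def)
  have "A * P = P * D"
  proof (rule eq_matI)
    fix i j assume "i < dim_row (P * D)" "j < dim_col (P * D)"
    with P D have ij: "i < n" "j < n" by auto
    have "(A * P) $$ (i, j) = (A *\<^sub>v col P j) $ i"
      using A P ij by simp
    also have "\<dots> = P $$ (i, j) * l j"
      using P ij by (subst eig) (auto simp: mult.commute)
    also have "\<dots> = (\<Sum>k = 0..<n. P $$ (i, k) * (if k = j then l j else 0))"
      using ij by (simp add: if_distrib[of "(*) _"] sum.delta cong: if_cong)
    also have "\<dots> = (P * D) $$ (i, j)"
      using P ij by (auto simp: D_def scalar_prod_def intro!: sum.cong)
    finally show "(A * P) $$ (i, j) = (P * D) $$ (i, j)" .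
  qed (use A P D in auto)
  then have "A = P * D * Q"
    using A P Q D by (metis assoc_mult_mat right_mult_one_mat)
  then have "similar_mat A D"
    using A P Q D by (intro similar_matI[of _ _ P Q n]) auto
  then have "char_poly A = (\<Prod>a\<leftarrow>diag_mat D. [:- a, 1:])"
    using char_poly_upper_triangular[OF D] by (simp add: char_poly_similar upper_triangular_def D_def)
  moreover have "diag_mat D = map l [0..<n]"
    by (auto simp: diag_mat_def D_def)
  moreover have "proots (\<Prod>a\<leftarrow>xs. [:- a, 1:]) = mset xs" for xs :: "'a list"
  proof (induction xs)
    case (Cons a xs)
    moreover have "(\<Prod>a\<leftarrow>xs. [:- a, 1:]) \<noteq> 0"
      by (auto simp: prod_list_zero_iff)
    ultimately show ?case
      by (simp add: proots_mult del: mult_pCons_left)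
  qed simp
  ultimately have "proots (char_poly A) = mset (map l [0..<n])"
    by metis
  then show ?thesis
    by simp
qed

text \<open>Each entry counts hyperedges; writing the count as a sum of ones and swapping the two
  summations turns the matrix action into sums over the hyperedges at \<open>v\<close>.\<close>

lemma sum_adjacency:
  fixes f :: "'v \<Rightarrow> real"
  assumes "finite V" "finite E" "\<And>e. e \<in> E \<Longrightarrow> e \<subseteq> V"
  shows "(\<Sum>u\<in>V. (if v = u then 0 else real (card {e \<in> E. {v, u} \<subseteq> e})) * f u) =
         (\<Sum>e | e \<in> E \<and> v \<in> e. \<Sum>u\<in>e - {v}. f u)"
proof -
  have "(\<Sum>u\<in>V. (if v = u then 0 else real (card {e \<in> E. {v, u} \<subseteq> e})) * f u) =
        (\<Sum>u\<in>V - {v}. real (card {e \<in> E. {v, u} \<subseteq> e}) * f u)"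
    using assms(1) by (intro sum.mono_neutral_cong_right) auto
  also have "\<dots> = (\<Sum>u\<in>V - {v}. \<Sum>e | e \<in> {e \<in> E. v \<in> e} \<and> u \<in> e. f u)"
    by (intro sum.cong) (auto intro!: arg_cong[of _ _ card] simp: conj_assoc)
  also have "\<dots> = (\<Sum>e | e \<in> E \<and> v \<in> e. \<Sum>u | u \<in> V - {v} \<and> u \<in> e. f u)"
    using assms by (intro sum.swap_restrict) auto
  also have "\<dots> = (\<Sum>e | e \<in> E \<and> v \<in> e. \<Sum>u\<in>e - {v}. f u)"
    using assms by (intro sum.cong) auto
  finally show ?thesis .
qed

text \<open>Indexing the eigenfunctions by the vertices makes the matrix of eigenvectors square by
  construction, so independence alone makes it invertible, and the enumeration \<open>vs\<close>
  disappears from the result.\<close>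

lemma adjacency_spectrum_eqI:
  assumes "hypergraph V E" "distinct vs" "set vs = V"
    and eig: "\<And>w v. w \<in> V \<Longrightarrow> v \<in> V \<Longrightarrow>
      (\<Sum>e | e \<in> E \<and> v \<in> e. \<Sum>u\<in>e - {v}. f w u) = l w * f w v"
    and indep: "\<And>c w. (\<And>v. v \<in> V \<Longrightarrow> (\<Sum>w\<in>V. c w * f w v) = 0) \<Longrightarrow> w \<in> V \<Longrightarrow> c w = 0"
  shows "adjacency_spectrum vs E = image_mset l (mset_set V)"
proof -
  define n where "n = length vs"
  define P where "P = mat n n (\<lambda>(i, j). f (vs ! j) (vs ! i))"
  have P: "P \<in> carrier_mat n n"
    by (simp add: P_def)
  have sum_vs: "(\<Sum>j = 0..<n. g (vs ! j)) = (\<Sum>w\<in>V. g w)" for g :: "'a \<Rightarrow> real"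
  proof -
    have "bij_betw ((!) vs) {0..<n} V"
      using bij_betw_nth[OF assms(2), of "{0..<n}" V] assms(3) by (simp add: n_def lessThan_atLeast0)
    then show ?thesis
      by (rule sum.reindex_bij_betw)
  qed
  have "det P \<noteq> 0"
  proof
    assume "det P = 0"
    then obtain x where x: "x \<in> carrier_vec n" "x \<noteq> 0\<^sub>v n" "P *\<^sub>v x = 0\<^sub>v n"
      using det_0_iff_vec_prod_zero[OF P] by auto
    \<comment> \<open>The kernel vector is read as a function on vertices; \<open>THE\<close>
      inverts the enumeration, which is injective because \<open>vs\<close> is distinct.\<close>
    define c where "c = (\<lambda>v. x $ (THE i. i < n \<and> vs ! i = v))"
    have c: "c (vs ! i) = x $ i" if "i < n" for i
    proof -
      have "(THE i'. i' < n \<and> vs ! i' = vs ! i) = i"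
        using that assms(2) by (intro the_equality) (auto simp: n_def nth_eq_iff_index_eq)
      then show ?thesis
        by (simp add: c_def)
    qed
    have "(\<Sum>w\<in>V. c w * f w v) = 0" if v: "v \<in> V" for v
    proof -
      obtain i where i: "i < n" "v = vs ! i"
        using v assms(3) unfolding n_def by (metis in_set_conv_nth)
      have "(\<Sum>w\<in>V. c w * f w v) = (\<Sum>j = 0..<n. c (vs ! j) * f (vs ! j) v)"
        by (rule sum_vs[symmetric])
      also have "\<dots> = (P *\<^sub>v x) $ i"
        using i x(1) by (auto simp: P_def scalar_prod_def c intro!: sum.cong)
      finally have "(\<Sum>w\<in>V. c w * f w v) = (P *\<^sub>v x) $ i" .
      then show ?thesis
        using x i by simp
    qed
    then have "c w = 0" if "w \<in> V" for w
      using indep that by blast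
    then have "x $ i = 0" if "i < n" for i
      using that c[of i] assms(3) unfolding n_def by (metis nth_mem)
    then show False
      using x by auto
  qed
  have "proots (char_poly (adjacency_matrix vs E)) = image_mset (\<lambda>j. l (vs ! j)) (mset [0..<n])"
  proof (rule proots_char_poly_diagonalizable[OF _ P \<open>det P \<noteq> 0\<close>])
    show "adjacency_matrix vs E \<in> carrier_mat n n"
      by (simp add: adjacency_matrix_def n_def)
    fix j assume j: "j < n"
    show "adjacency_matrix vs E *\<^sub>v col P j = l (vs ! j) \<cdot>\<^sub>v col P j"
    proof (rule eq_vecI)
      fix i assume "i < dim_vec (l (vs ! j) \<cdot>\<^sub>v col P j)"
      then have i: "i < n"
        by (simp add: P_def)
      have mem: "vs ! i \<in> V" "vs ! j \<in> V"
        using i j assms(3) by (auto simp: n_def)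
      have "(adjacency_matrix vs E *\<^sub>v col P j) $ i =
        (\<Sum>m = 0..<n. (if vs ! i = vs ! m then 0
            else real (card {e \<in> E. {vs ! i, vs ! m} \<subseteq> e})) * f (vs ! j) (vs ! m))"
        using i j assms(2)
        by (auto simp: adjacency_matrix_def P_def scalar_prod_def nth_eq_iff_index_eq
            simp flip: n_def intro!: sum.cong)
      also have "\<dots> = (\<Sum>u\<in>V. (if vs ! i = u then 0
            else real (card {e \<in> E. {vs ! i, u} \<subseteq> e})) * f (vs ! j) u)"
        by (rule sum_vs)
      also have "\<dots> = l (vs ! j) * f (vs ! j) (vs ! i)"
        using assms(1) mem by (subst sum_adjacency) (auto simp: hypergraph_def eig)
      finally show "(adjacency_matrix vs E *\<^sub>v col P j) $ i = (l (vs ! j) \<cdot>\<^sub>v col P j) $ i"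
        using i j by (simp add: P_def)
    qed (simp add: P_def adjacency_matrix_def n_def)
  qed
  also have "\<dots> = mset (map l (map ((!) vs) [0..<n]))"
    by (simp add: comp_def)
  also have "\<dots> = image_mset l (mset_set V)"
    unfolding n_def map_nth assms(3)[symmetric] mset_set_set[OF assms(2)] by simp
  finally show ?thesis
    by (simp add: adjacency_spectrum_def)
qed

section \<open>Adjacency action and eigenfunctions of the sunflower\<close>

text \<open>The centre lies only in the central hyperedge, an outer vertex only in its petal, and an
  inner vertex in both, which is why \<open>f v\<close> is then subtracted twice.\<close>

lemma sum_sunflower_neighbours:
  fixes f :: "nat \<times> nat \<Rightarrow> real"
  assumes "k \<ge> 2" "v \<in> sunflower_vertices k"
  shows "(\<Sum>e | e \<in> sunflower_edges k \<and> v \<in> e. \<Sum>u\<in>e - {v}. f u) =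
    (if v = (0, 0) then \<Sum>i = 1..k - 1. f (i, 1)
     else (\<Sum>j = 1..k. f (fst v, j)) - f v +
       (if snd v = 1 then f (0, 0) + (\<Sum>i = 1..k - 1. f (i, 1)) - f v else 0))"
proof -
  define c :: "(nat \<times> nat) set" where "c = insert (0, 0) ((\<lambda>i. (i, 1)) ` {1..k - 1})"
  define p :: "nat \<Rightarrow> (nat \<times> nat) set" where "p = (\<lambda>i. Pair i ` {1..k})"
  have E: "sunflower_edges k = insert c (p ` {1..k - 1})"
    unfolding sunflower_edges_def c_def p_def setcompr_eq_image Collect_mem_eq ..
  have sum_c: "(\<Sum>u\<in>c. f u) = f (0, 0) + (\<Sum>i = 1..k - 1. f (i, 1))"
    unfolding c_def by (subst sum.insert) (auto simp: sum.reindex inj_on_def)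
  have sum_p: "(\<Sum>u\<in>p i. f u) = (\<Sum>j = 1..k. f (i, j))" for i
    unfolding p_def by (subst sum.reindex) (auto simp: inj_on_def)
  have fin: "finite c" "finite (p i)" for i
    by (auto simp: c_def p_def)
  have cp: "c \<noteq> p i" for i
  proof -
    have "(0, 0) \<in> c - p i"
      by (auto simp: c_def p_def)
    then show ?thesis
      by blast
  qed
  consider "v = (0, 0)" | i where "v = (i, 1)" "i \<in> {1..k - 1}"
    | i j where "v = (i, j)" "i \<in> {1..k - 1}" "j \<in> {2..k}"
    using assms by (cases v) (force simp: sunflower_vertices_def)
  then show ?thesis
  proof cases
    case 1
    then have "{e. e \<in> sunflower_edges k \<and> v \<in> e} = {c}"
      by (auto simp: E c_def p_def)
    moreover have "v \<in> c"
      using 1 by (simp add: c_def)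
    ultimately show ?thesis
      using 1 sum_c fin by (simp add: sum_diff1)
  next
    case 2
    then have "{e. e \<in> sunflower_edges k \<and> v \<in> e} = {c, p i}"
      using assms(1) by (auto simp: E c_def p_def)
    moreover have "v \<in> c" "v \<in> p i"
      using 2 assms(1) by (auto simp: c_def p_def)
    ultimately show ?thesis
      using 2 sum_c sum_p fin cp by (simp add: sum_diff1)
  next
    case 3
    then have "{e. e \<in> sunflower_edges k \<and> v \<in> e} = {p i}"
      by (auto simp: E c_def p_def)
    moreover have "v \<in> p i"
      using 3 by (auto simp: p_def)
    ultimately show ?thesis
      using 3 sum_p fin by (simp add: sum_diff1)
  qed
qed

text \<open>
  The eigenvectors are indexed by the vertices themselves: $(i,j)$ with $j \ge 3$ stands for an
  eigenvector for $-1$ on petal $i$, $(i,1)$ and $(i,2)$ with $i \ge 2$ for the two quadratic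
  eigenvalues on the difference of petals $i$ and $1$, and $(0,0)$, $(1,1)$, $(1,2)$ for the three
  cubic eigenvalues. The function $l$ assigns to an index its eigenvalue.
\<close>

definition sunflower_eigenfunction :: "nat \<Rightarrow> (nat \<times> nat \<Rightarrow> real) \<Rightarrow>
    nat \<times> nat \<Rightarrow> nat \<times> nat \<Rightarrow> real" where
  "sunflower_eigenfunction k l w v = (let b = l w - (real k - 2) in
     if snd w \<ge> 3 then of_bool (v = w) - of_bool (v = (fst w, 2))
     else if fst w \<ge> 2 then
       (of_bool (fst v = fst w) - of_bool (fst v = 1)) * (if snd v = 1 then b else 1)
     else if v = (0, 0) then b\<^sup>2 - (real k - 1)
     else if snd v = 1 then b else 1)"

lemma sum_atLeast1_split:
  fixes f :: "nat \<Rightarrow> real"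
  assumes "k \<ge> 2" "\<And>j. j \<in> {2..k} \<Longrightarrow> f j = a"
  shows "(\<Sum>j = 1..k. f j) = f 1 + (real k - 1) * a"
proof -
  have "{1..k} = insert 1 {2..k}" using assms(1) by auto
  with assms show ?thesis by (simp add: of_nat_diff)
qed

text \<open>For functions constant on the outer part of each petal, the choice of \<open>b\<close>
  settles the outer equations. The remaining conditions are the inner equation
  \<open>(l w + 1) * b = k - 1\<close> for petal differences, which is the quadratic, and the centre
  equation \<open>l w * (b^2 - (k - 1)) = (k - 1) * b\<close> for symmetric functions, which is the
  cubic.\<close>

lemma sunflower_eigenfunction:
  assumes k: "k \<ge> 2" and w: "w \<in> sunflower_vertices k" and v: "v \<in> sunflower_vertices k"
    and outer: "\<And>i j. j \<ge> 3 \<Longrightarrow> l (i, j) = -1"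
    and quadratic: "\<And>i j. i \<ge> 2 \<Longrightarrow> j < 3 \<Longrightarrow>
      (l (i, j))\<^sup>2 - (real k - 3) * l (i, j) - (2 * real k - 3) = 0"
    and cubic: "\<And>i j. i < 2 \<Longrightarrow> j < 3 \<Longrightarrow> (l (i, j)) ^ 3 - 2 * (real k - 2) * (l (i, j))\<^sup>2 +
      ((real k)\<^sup>2 - 6 * real k + 6) * l (i, j) + (real k - 1) * (real k - 2) = 0"
  shows "(\<Sum>e | e \<in> sunflower_edges k \<and> v \<in> e. \<Sum>u\<in>e - {v}. sunflower_eigenfunction k l w u) =
    l w * sunflower_eigenfunction k l w v"
proof -
  define F where "F = sunflower_eigenfunction k l w"
  obtain i j where wij: "w = (i, j)" by (cases w)
  obtain i' j' where vij: "v = (i', j')" by (cases v)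
  have v': "v = (0, 0) \<or> i' \<in> {1..k - 1} \<and> j' \<in> {1..k}"
    using v by (auto simp: vij sunflower_vertices_def)
  have w': "w = (0, 0) \<or> i \<in> {1..k - 1} \<and> j \<in> {1..k}"
    using w by (auto simp: wij sunflower_vertices_def)
  define b where "b = l w - (real k - 2)"
  consider "j \<ge> 3" | "j < 3" "i \<ge> 2" | "j < 3" "i < 2" by linarith
  then have "(\<Sum>e | e \<in> sunflower_edges k \<and> v \<in> e. \<Sum>u\<in>e - {v}. F u) = l w * F v"
  proof cases
    case 1
    then have f: "F = (\<lambda>v. of_bool (v = w) - of_bool (v = (i, 2)))" and lw: "l (i, j) = -1"
      by (auto simp: F_def sunflower_eigenfunction_def fun_eq_iff wij outer Let_def)
    \<comment> \<open>The values 1 and -1 sit on the same petal and cancel, so the neighbour sum at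
      an outer vertex is just \<open>- F v\<close>.\<close>
    have "(\<Sum>m = 1..k. F (i', m)) = 0"
    proof (cases "i' = i")
      case True
      then have "(\<Sum>m = 1..k. F (i', m)) = (\<Sum>m = 1..k. of_bool (m = j)) - (\<Sum>m = 1..k. of_bool (m = 2))"
        by (simp add: f wij sum_subtractf)
      also have "\<dots> = 0"
        using 1 w' k by (auto simp: wij of_bool_def sum.delta)
      finally show ?thesis .
    qed (simp add: f wij)
    moreover have "(\<Sum>m = 1..k - 1. F (m, 1)) = 0"
      using 1 by (simp add: f wij)
    ultimately show ?thesis
      using 1 w' by (subst sum_sunflower_neighbours[OF k v]) (auto simp: f lw wij vij)
  next
    case 2
    then have f: "F = (\<lambda>v. (of_bool (fst v = i) - of_bool (fst v = 1)) * (if snd v = 1 then b else 1))"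
      by (auto simp: F_def sunflower_eigenfunction_def fun_eq_iff wij Let_def b_def)
    have i: "i \<in> {1..k - 1}"
      using 2 w' by (auto simp: wij)
    have quad: "(l w)\<^sup>2 - (real k - 3) * l w - (2 * real k - 3) = 0"
      using quadratic[OF 2(2,1)] by (simp add: wij)
    have "(\<Sum>m = 1..k. F (i', m)) = (of_bool (i' = i) - of_bool (i' = 1)) * (b + (real k - 1))"
      by (subst sum_atLeast1_split[OF k, of _ "of_bool (i' = i) - of_bool (i' = 1)"])
        (auto simp: f algebra_simps)
    \<comment> \<open>The inner values \<open>b\<close> on petal \<open>i\<close> and
      \<open>- b\<close> on petal 1 cancel. The centre also has value 0, since its first index 0 is
      neither \<open>i\<close> nor 1.\<close>
    moreover have "(\<Sum>m = 1..k - 1. F (m, 1)) = 0"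
    proof -
      have "(\<Sum>m = 1..k - 1. F (m, 1)) =
          b * ((\<Sum>m = 1..k - 1. of_bool (m = i)) - (\<Sum>m = 1..k - 1. of_bool (m = 1)))"
        by (simp add: f sum_distrib_left right_diff_distrib mult.commute[of _ b] sum_subtractf del: sum_of_bool_eq)
      also have "\<dots> = 0"
        using i k by (auto simp: of_bool_def sum.delta)
      finally show ?thesis .
    qed
    moreover have "b + (real k - 1) - 2 * b = l w * b" "b + (real k - 1) - 1 = l w"
      using quad by (auto simp: b_def algebra_simps power2_eq_square)
    ultimately show ?thesis
      using i 2(2)
      by (subst sum_sunflower_neighbours[OF k v]) (auto simp: f vij algebra_simps)
  next
    case 3
    then have f: "F = (\<lambda>v. if v = (0, 0) then b\<^sup>2 - (real k - 1) else if snd v = 1 then b else 1)"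
      by (auto simp: F_def sunflower_eigenfunction_def fun_eq_iff wij Let_def b_def)
    have cub: "(l w) ^ 3 - 2 * (real k - 2) * (l w)\<^sup>2 +
      ((real k)\<^sup>2 - 6 * real k + 6) * l w + (real k - 1) * (real k - 2) = 0"
      using cubic[OF 3(2,1)] by (simp add: wij)
    have "(\<Sum>m = 1..k. F (i', m)) = b + (real k - 1)" if "i' \<noteq> 0"
      using that by (subst sum_atLeast1_split[OF k, of _ "1"]) (auto simp: f)
    moreover have "(\<Sum>m = 1..k - 1. F (m, 1)) = (real k - 1) * b"
      using k by (simp add: f of_nat_diff)
    moreover have "(real k - 1) * b = l w * (b\<^sup>2 - (real k - 1))"
      using cub by (simp add: b_def algebra_simps eval_nat_numeral)
    \<comment> \<open>The inner equation is an identity in \<open>l w\<close>: the centre value was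
      chosen to make it hold.\<close>
    moreover have "b + (real k - 1) - b + (b\<^sup>2 - (real k - 1) + (real k - 1) * b - b) = l w * b"
      "b + (real k - 1) - 1 = l w"
      by (auto simp: b_def algebra_simps power2_eq_square)
    ultimately show ?thesis
      using v' by (subst sum_sunflower_neighbours[OF k v]) (auto simp: f vij)
  qed
  then show ?thesis by (simp add: F_def)
qed

section \<open>Linear independence of the eigenfunctions\<close>

text \<open>Groups the vertices by their role as eigenfunction indices: cubic, quadratic, and
  eigenvalue -1. The values lie in any commutative monoid, so that the splitting serves both linear
  combinations and multisets of eigenvalues.\<close>

lemma sum_sunflower_vertices:
  fixes g :: "nat \<times> nat \<Rightarrow> 'a :: comm_monoid_add"
  assumes "k \<ge> 2"
  shows "(\<Sum>w\<in>sunflower_vertices k. g w) = g (0, 0) + g (1, 1) + g (1, 2) +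
    (\<Sum>i = 2..k - 1. g (i, 1) + g (i, 2)) + (\<Sum>i = 1..k - 1. \<Sum>j = 3..k. g (i, j))"
proof -
  have j: "{1..k} = insert 1 (insert 2 {3..k})" and i: "{1..k - 1} = insert 1 {2..k - 1}"
    using assms by auto
  have "(\<Sum>w\<in>sunflower_vertices k. g w) = g (0, 0) + (\<Sum>w\<in>{1..k - 1} \<times> {1..k}. g w)"
    unfolding sunflower_vertices_def by (subst sum.insert) auto
  also have "(\<Sum>w\<in>{1..k - 1} \<times> {1..k}. g w) = (\<Sum>i = 1..k - 1. \<Sum>j = 1..k. g (i, j))"
    by (simp add: sum.cartesian_product)
  also have "\<dots> = (\<Sum>i = 1..k - 1. g (i, 1) + g (i, 2)) + (\<Sum>i = 1..k - 1. \<Sum>j = 3..k. g (i, j))"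
    unfolding j by (simp add: sum.distrib add.assoc)
  also have "(\<Sum>i = 1..k - 1. g (i, 1) + g (i, 2)) =
      g (1, 1) + g (1, 2) + (\<Sum>i = 2..k - 1. g (i, 1) + g (i, 2))"
    unfolding i by (simp add: add.assoc)
  finally show ?thesis
    by (simp add: add.assoc)
qed

text \<open>Every \<open>X i\<close> equals \<open>- s\<close>, so the first equation collects
  \<open>1 + (k - 2)\<close> copies of \<open>s\<close>. It separates the symmetric part
  \<open>s\<close> of a combination from its petal differences \<open>X i\<close>, which enter petal
  1 with a minus sign.\<close>

lemma zero_of_sum_and_shifts:
  fixes X :: "nat \<Rightarrow> real"
  assumes "k \<ge> 2" "s - (\<Sum>i = 2..k - 1. X i) = 0" "\<And>i. i \<in> {2..k - 1} \<Longrightarrow> s + X i = 0"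
  shows "s = 0" "i \<in> {2..k - 1} \<Longrightarrow> X i = 0"
proof -
  have "(\<Sum>i = 2..k - 1. X i) = (\<Sum>i = 2..k - 1. - s)"
    using assms(3) by (intro sum.cong) (auto simp: add_eq_0_iff)
  then have "(real k - 1) * s = 0"
    using assms(1,2) by (simp add: of_nat_diff algebra_simps)
  then show "s = 0"
    using assms(1) by simp
  then show "i \<in> {2..k - 1} \<Longrightarrow> X i = 0"
    using assms(3) by force
qed

lemma sunflower_eigenfunction_independent:
  assumes k: "k \<ge> 2"
    and distinct2: "\<And>i. i \<ge> 2 \<Longrightarrow> l (i, 1) \<noteq> l (i, 2)"
    and distinct3: "l (0, 0) \<noteq> l (1, 1)" "l (0, 0) \<noteq> l (1, 2)" "l (1, 1) \<noteq> l (1, 2)"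
    and zero: "\<And>v. v \<in> sunflower_vertices k \<Longrightarrow>
      (\<Sum>w\<in>sunflower_vertices k. c w * sunflower_eigenfunction k l w v) = 0"
    and w: "w \<in> sunflower_vertices k"
  shows "c w = 0"
proof -
  define b where "b = (\<lambda>w. l w - (real k - 2))"
  \<comment> \<open>Eigenfunctions other than those for -1 take values built from powers of
    \<open>b\<close>: exponent 0 outside, 1 inside. Hence \<open>s n\<close> and
    \<open>x n i\<close> are moments of the coefficients, and \<open>z n m\<close> is the resulting
    value on petal \<open>m\<close>.\<close>
  define s where "s = (\<lambda>n. c (0, 0) * b (0, 0) ^ n + c (1, 1) * b (1, 1) ^ n + c (1, 2) * b (1, 2) ^ n)"
  define x where "x = (\<lambda>n i. c (i, 1) * b (i, 1) ^ n + c (i, 2) * b (i, 2) ^ n)"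
  define z where "z = (\<lambda>n m. s n + (if m = 1 then - (\<Sum>i = 2..k - 1. x n i) else x n m))"
  have sum_x: "(\<Sum>i = 2..k - 1. (of_bool (m = i) - of_bool (m = 1)) * x n i) =
      (if m = 1 then - (\<Sum>i = 2..k - 1. x n i) else x n m)" if "m \<in> {1..k - 1}" for n m
    using that by (auto simp: of_bool_def if_distrib[of "\<lambda>a. a * _"] sum_negf sum.delta' cong: if_cong)
  have sum_z: "(\<Sum>w\<in>sunflower_vertices k. c w * sunflower_eigenfunction k l w (m, n)) =
      z (if n = 1 then 1 else 0) m +
      (\<Sum>j = 3..k. c (m, j) * (of_bool (n = j) - of_bool (n = 2)))"
    if m: "m \<in> {1..k - 1}" for m n
  proof -
    have "(\<Sum>i = 1..k - 1. \<Sum>j = 3..k. c (i, j) * sunflower_eigenfunction k l (i, j) (m, n)) =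
      (\<Sum>i = 1..k - 1. if m = i then \<Sum>j = 3..k. c (i, j) * (of_bool (n = j) - of_bool (n = 2)) else 0)"
      by (intro sum.cong) (auto simp: sunflower_eigenfunction_def intro!: sum.cong sum.neutral)
    also have "\<dots> = (\<Sum>j = 3..k. c (m, j) * (of_bool (n = j) - of_bool (n = 2)))"
      using m by (simp add: sum.delta')
    finally have outer: "(\<Sum>i = 1..k - 1. \<Sum>j = 3..k. c (i, j) * sunflower_eigenfunction k l (i, j) (m, n)) = \<dots>" .
    have "(\<Sum>i = 2..k - 1. c (i, 1) * sunflower_eigenfunction k l (i, 1) (m, n) +
          c (i, 2) * sunflower_eigenfunction k l (i, 2) (m, n)) =
        (\<Sum>i = 2..k - 1. (of_bool (m = i) - of_bool (m = 1)) * x (if n = 1 then 1 else 0) i)"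
      by (intro sum.cong) (auto simp: sunflower_eigenfunction_def x_def b_def Let_def algebra_simps)
    also have "\<dots> = z (if n = 1 then 1 else 0) m - s (if n = 1 then 1 else 0)"
      by (subst sum_x[OF m]) (simp add: z_def)
    finally have petals: "(\<Sum>i = 2..k - 1. c (i, 1) * sunflower_eigenfunction k l (i, 1) (m, n) +
          c (i, 2) * sunflower_eigenfunction k l (i, 2) (m, n)) = \<dots>" .
    show ?thesis
      using m unfolding sum_sunflower_vertices[OF k] outer petals
      by (auto simp: sunflower_eigenfunction_def s_def b_def Let_def)
  qed
  \<comment> \<open>The vertices \<open>(m, n)\<close> with \<open>n \<ge> 3\<close> give
    \<open>c (m, n) = - z 0 m\<close>. At \<open>(m, 2)\<close>, where each of these functions is
    -1, substitution leaves \<open>(k - 1) * z 0 m = 0\<close>.\<close>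
  have z: "z 0 m = 0 \<and> (\<forall>j\<in>{3..k}. c (m, j) = 0)" if m: "m \<in> {1..k - 1}" for m
  proof -
    have c: "c (m, n) = - z 0 m" if n: "n \<in> {3..k}" for n
    proof -
      have "z 0 m + (\<Sum>j = 3..k. c (m, j) * (of_bool (n = j) - of_bool (n = 2))) = 0"
        using zero[of "(m, n)"] sum_z[OF m, of n] m n by (auto simp: sunflower_vertices_def)
      moreover have "(\<Sum>j = 3..k. c (m, j) * (of_bool (n = j) - of_bool (n = 2))) = c (m, n)"
        using n by (auto simp: of_bool_def if_distrib[of "(*) _"] sum.delta' cong: if_cong)
      ultimately show ?thesis
        by simp
    qed
    have "z 0 m - (\<Sum>j = 3..k. c (m, j)) = 0"
      using zero[of "(m, 2)"] sum_z[OF m, of 2] m k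
      by (auto simp: sunflower_vertices_def sum_negf)
    moreover have "(\<Sum>j = 3..k. c (m, j)) = - (real k - 2) * z 0 m"
      using k by (simp add: c of_nat_diff algebra_simps)
    ultimately have "(real k - 1) * z 0 m = 0"
      by (simp add: algebra_simps)
    then show ?thesis
      using k c by simp
  qed
  have z1: "z 1 m = 0" if m: "m \<in> {1..k - 1}" for m
    using zero[of "(m, 1)"] sum_z[OF m, of 1] m k by (auto simp: sunflower_vertices_def)
  have sx: "s n = 0" "i \<in> {2..k - 1} \<Longrightarrow> x n i = 0" if "\<And>m. m \<in> {1..k - 1} \<Longrightarrow> z n m = 0" for n i
  proof -
    have "s n - (\<Sum>i = 2..k - 1. x n i) = 0"
      using that[of 1] k by (simp add: z_def)
    moreover have "s n + x n i = 0" if "i \<in> {2..k - 1}" for i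
      using \<open>\<And>m. m \<in> {1..k - 1} \<Longrightarrow> z n m = 0\<close>[of i] that by (simp add: z_def)
    ultimately show "s n = 0" "i \<in> {2..k - 1} \<Longrightarrow> x n i = 0"
      using zero_of_sum_and_shifts[OF k] by blast+
  qed
  have s01: "s 0 = 0" "s 1 = 0"
    using sx(1)[of 0] sx(1)[of 1] z z1 by blast+
  \<comment> \<open>Only the three symmetric functions are supported at the centre; their value
    \<open>b^2 - (k - 1)\<close> there supplies the missing second moment.\<close>
  have "s 2 - (real k - 1) * s 0 = (\<Sum>w\<in>sunflower_vertices k. c w * sunflower_eigenfunction k l w (0, 0))"
    unfolding sum_sunflower_vertices[OF k]
    by (simp add: sunflower_eigenfunction_def s_def b_def Let_def algebra_simps)
  then have "s 2 = 0"
    using zero[of "(0, 0)"] s01 by (simp add: sunflower_vertices_def)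
  \<comment> \<open>Vandermonde elimination: the quadratic polynomial vanishing at two of the nodes
    \<open>b\<close> isolates the coefficient of the third.\<close>
  have "c (0, 0) * (b (0, 0) - b (1, 1)) * (b (0, 0) - b (1, 2)) =
      s 2 - (b (1, 1) + b (1, 2)) * s 1 + b (1, 1) * b (1, 2) * s 0"
    "c (1, 1) * (b (1, 1) - b (0, 0)) * (b (1, 1) - b (1, 2)) =
      s 2 - (b (0, 0) + b (1, 2)) * s 1 + b (0, 0) * b (1, 2) * s 0"
    "c (1, 2) * (b (1, 2) - b (0, 0)) * (b (1, 2) - b (1, 1)) =
      s 2 - (b (0, 0) + b (1, 1)) * s 1 + b (0, 0) * b (1, 1) * s 0"
    by (simp_all add: s_def algebra_simps power2_eq_square)
  then have inner: "c (0, 0) = 0" "c (1, 1) = 0" "c (1, 2) = 0"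
    using distinct3 s01 \<open>s 2 = 0\<close> by (auto simp: b_def)
  have "c (i, 1) = 0 \<and> c (i, 2) = 0" if i: "i \<in> {2..k - 1}" for i
  proof -
    have "c (i, 1) * (b (i, 1) - b (i, 2)) = x 1 i - b (i, 2) * x 0 i"
      "c (i, 2) * (b (i, 2) - b (i, 1)) = x 1 i - b (i, 1) * x 0 i"
      by (simp_all add: x_def algebra_simps)
    then show ?thesis
      using sx(2)[of 0 i] sx(2)[of 1 i] z z1 i distinct2[of i] by (auto simp: b_def)
  qed
  moreover have "w = (0, 0) \<or> (\<exists>i\<in>{1..k - 1}. \<exists>j\<in>{3..k}. w = (i, j)) \<or> w = (1, 1) \<or> w = (1, 2) \<or>
      (\<exists>i\<in>{2..k - 1}. w = (i, 1) \<or> w = (i, 2))"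
    using w by (cases w) (force simp: sunflower_vertices_def)
  ultimately show ?thesis
    using z inner by blast
qed

section \<open>Trigonometric solution of the cubic\<close>

text \<open>The shift by \<open>2 * (k - 2) / 3\<close> removes the quadratic term, and the scale
  \<open>2 * R / 3\<close> matches the rest with the triple-angle formula, so only
  \<open>cos (3 * \<phi>)\<close> matters.\<close>

lemma viete_cubic_root:
  fixes k \<phi> :: real
  defines "R \<equiv> sqrt (- 2 + 2 * k + k\<^sup>2)"
  assumes "- 2 + 2 * k + k\<^sup>2 \<ge> 0"
    and "2 * R ^ 3 * cos (3 * \<phi>) = 34 - 51 * k + 21 * k\<^sup>2 - 2 * k ^ 3"
    and "x = 2 / 3 * (- 2 + k + R * cos \<phi>)"
  shows "x ^ 3 - 2 * (k - 2) * x\<^sup>2 + (k\<^sup>2 - 6 * k + 6) * x + (k - 1) * (k - 2) = 0"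
proof -
  have R: "R * R = - 2 + 2 * k + k\<^sup>2"
    using assms(2) by (simp add: R_def)
  have "2 * R ^ 3 * (4 * cos \<phi> ^ 3 - 3 * cos \<phi>) = 34 - 51 * k + 21 * k\<^sup>2 - 2 * k ^ 3"
    using assms(3) by (simp add: cos_treble_cos)
  moreover have "27 * (x ^ 3 - 2 * (k - 2) * x\<^sup>2 + (k\<^sup>2 - 6 * k + 6) * x + (k - 1) * (k - 2)) =
      8 * (R * cos \<phi>) ^ 3 - 6 * (- 2 + 2 * k + k\<^sup>2) * (R * cos \<phi>) -
        (34 - 51 * k + 21 * k\<^sup>2 - 2 * k ^ 3)"
    (is "_ = ?t - _")
    unfolding assms(4) by (simp add: field_simps power2_eq_square power3_eq_cube)
  moreover have "?t = 2 * R ^ 3 * (4 * cos \<phi> ^ 3 - 3 * cos \<phi>)"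
    unfolding R[symmetric] by (simp add: algebra_simps eval_nat_numeral)
  ultimately have "27 * (x ^ 3 - 2 * (k - 2) * x\<^sup>2 + (k\<^sup>2 - 6 * k + 6) * x + (k - 1) * (k - 2)) = 0"
    by linarith
  then show ?thesis
    by simp
qed

text \<open>The difference of the two sides is 27 times the discriminant of the cubic; its
  positivity puts the argument of \<open>arccos\<close> strictly between -1 and 1.\<close>

lemma sunflower_discriminant_pos:
  fixes k :: real
  assumes "k \<ge> 2"
  shows "(34 - 51 * k + 21 * k\<^sup>2 - 2 * k ^ 3)\<^sup>2 < 4 * (- 2 + 2 * k + k\<^sup>2) ^ 3"
proof -
  \<comment> \<open>Expanding around the least admissible \<open>k\<close> makes every coefficient
    of the difference positive.\<close>
  define m where "m = k - 2"
  have "k = m + 2" "m \<ge> 0"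
    using assms by (auto simp: m_def)
  have "4 * (- 2 + 2 * k + k\<^sup>2) ^ 3 - (34 - 51 * k + 21 * k\<^sup>2 - 2 * k ^ 3)\<^sup>2 =
      108 * m ^ 5 + 459 * m ^ 4 + 1566 * m ^ 3 + 2943 * m\<^sup>2 + 2592 * m + 864"
    unfolding \<open>k = m + 2\<close> by (simp add: algebra_simps eval_nat_numeral)
  also have "\<dots> > 0"
    using \<open>m \<ge> 0\<close> by (intro add_nonneg_pos) auto
  finally show ?thesis
    by simp
qed

text \<open>Replacing \<open>(\<theta> + 4 * pi) / 3\<close> by its reflection
  \<open>(2 * pi - \<theta>) / 3\<close> puts all three angles into the interval from 0 to
  \<open>pi\<close>, where the cosine decreases strictly.\<close>

lemma cos_thirds_strict:
  assumes "0 < \<theta>" "\<theta> < pi"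
  shows "cos (\<theta> / 3) > cos ((\<theta> + 4 * pi) / 3)" "cos ((\<theta> + 4 * pi) / 3) > cos ((\<theta> + 2 * pi) / 3)"
proof -
  have "cos ((\<theta> + 4 * pi) / 3) = cos ((2 * pi - \<theta>) / 3)"
    using cos_2pi_minus[of "(2 * pi - \<theta>) / 3"] by (simp add: field_simps)
  then show "cos (\<theta> / 3) > cos ((\<theta> + 4 * pi) / 3)" "cos ((\<theta> + 4 * pi) / 3) > cos ((\<theta> + 2 * pi) / 3)"
    using assms by (auto intro!: cos_monotone_0_pi)
qed

section \<open>Assembling the spectrum\<close>

lemma image_mset_mset_set_eq_sum: "image_mset f (mset_set A) = (\<Sum>x\<in>A. {#f x#})"
  by (induction A rule: infinite_finite_induct) auto

lemma sum_singleton_mset_const: "(\<Sum>x\<in>A. {#a#}) = replicate_mset (card A) a"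
  by (induction A rule: infinite_finite_induct) auto

theorem corollary6p2:
  fixes k :: nat and vs :: "(nat \<times> nat) list" and \<theta> :: real and r :: "nat \<Rightarrow> real"
  assumes "k \<ge> 2"
    and "distinct vs" and "set vs = sunflower_vertices k"
    and "\<theta> = arccos ((34 - 51 * real k + 21 * real k ^ 2 - 2 * real k ^ 3)
                     / (2 * sqrt ((- 2 + 2 * real k + real k ^ 2) ^ 3)))"
    and "\<forall>i\<in>{1, 2, 3}. r i = 2 / 3 * (- 2 + real k
           + sqrt (- 2 + 2 * real k + real k ^ 2) * cos ((\<theta> + 2 * (real i - 1) * pi) / 3))"
  shows "adjacency_spectrum vs (sunflower_edges k) =
           replicate_mset ((k - 1) * (k - 2)) (- 1)
         + replicate_mset (k - 2) (((real k - 3) + sqrt ((real k + 3) * (real k - 1))) / 2)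
         + replicate_mset (k - 2) (((real k - 3) - sqrt ((real k + 3) * (real k - 1))) / 2)
         + {#r 1, r 2, r 3#}"
proof -
  define D where "D = - 2 + 2 * real k + (real k)\<^sup>2"
  define C where "C = 34 - 51 * real k + 21 * (real k)\<^sup>2 - 2 * real k ^ 3"
  have k: "real k \<ge> 2"
    using assms(1) by simp
  have "D > 0"
    using k by (simp add: D_def add_pos_nonneg)
  have R3: "sqrt (D ^ 3) = sqrt D ^ 3"
    by (simp add: real_sqrt_power)
  have "C\<^sup>2 < (2 * sqrt D ^ 3)\<^sup>2"
    using sunflower_discriminant_pos[OF k, folded D_def C_def] \<open>D > 0\<close>
    by (simp add: power_mult_distrib flip: R3)
  then have "\<bar>C\<bar> < 2 * sqrt D ^ 3"
    using \<open>D > 0\<close> by (intro power2_less_imp_less[of "\<bar>C\<bar>"]) auto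
  then have arg: "\<bar>C / (2 * sqrt D ^ 3)\<bar> < 1"
    using \<open>D > 0\<close> by (simp add: abs_mult)
  have \<theta>: "\<theta> = arccos (C / (2 * sqrt D ^ 3))"
    using assms(4)[folded D_def C_def] by (simp only: R3)
  have \<theta>_bounds: "0 < \<theta>" "\<theta> < pi" and cos_\<theta>: "2 * sqrt D ^ 3 * cos \<theta> = C"
    using arccos_lt_bounded[of "C / (2 * sqrt D ^ 3)"] cos_arccos_abs[of "C / (2 * sqrt D ^ 3)"] arg \<open>D > 0\<close>
    unfolding \<theta> abs_less_iff by (linarith, linarith, simp add: less_imp_le abs_less_iff)
  have r: "r 1 = 2 / 3 * (- 2 + real k + sqrt D * cos (\<theta> / 3))"
    "r 2 = 2 / 3 * (- 2 + real k + sqrt D * cos ((\<theta> + 2 * pi) / 3))"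
    "r 3 = 2 / 3 * (- 2 + real k + sqrt D * cos ((\<theta> + 4 * pi) / 3))"
    using assms(5)[folded D_def] by simp_all
  have r_distinct: "r 2 < r 3" "r 3 < r 1"
    using cos_thirds_strict[OF \<theta>_bounds] \<open>D > 0\<close> unfolding r by auto
  \<comment> \<open>Tripling the three angles gives \<theta> up to full periods, so
    \<open>viete_cubic_root\<close> covers all three roots.\<close>
  have four_pi: "\<theta> + 4 * pi = \<theta> + 2 * pi + 2 * pi" and thirds: "3 * (x / 3) = x" for x :: real
    by simp_all
  have cos_3: "cos (3 * (\<theta> / 3)) = cos \<theta>"
    "cos (3 * ((\<theta> + 2 * pi) / 3)) = cos \<theta>"
    "cos (3 * ((\<theta> + 4 * pi) / 3)) = cos \<theta>"
    unfolding thirds four_pi by (simp_all only: cos_periodic)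
  have cubic: "x ^ 3 - 2 * (real k - 2) * x\<^sup>2 + ((real k)\<^sup>2 - 6 * real k + 6) * x
      + (real k - 1) * (real k - 2) = 0" if x: "x \<in> {r 1, r 2, r 3}" for x
  proof -
    obtain \<phi> where \<phi>: "x = 2 / 3 * (- 2 + real k + sqrt D * cos \<phi>)" "cos (3 * \<phi>) = cos \<theta>"
      using x r cos_3 by blast
    have "2 * sqrt D ^ 3 * cos (3 * \<phi>) = C"
      unfolding \<phi>(2) by (rule cos_\<theta>)
    from viete_cubic_root[of "real k", folded D_def C_def, OF less_imp_le[OF \<open>D > 0\<close>] this \<phi>(1)]
    show ?thesis .
  qed
  \<comment> \<open>The radicand is the discriminant \<open>(k - 3)^2 + 4 * (2 * k - 3)\<close> of
    the quadratic; \<open>q S\<close> and \<open>q (- S)\<close> are its roots.\<close>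
  define S where "S = sqrt ((real k + 3) * (real k - 1))"
  have S: "S\<^sup>2 = (real k + 3) * (real k - 1)" "S > 0"
    using k by (auto simp: S_def)
  define q where "q = (\<lambda>s. (real k - 3 + s) / 2)"
  have quadratic: "(q s)\<^sup>2 - (real k - 3) * q s - (2 * real k - 3) = 0" if "s\<^sup>2 = S\<^sup>2" for s
    using that unfolding S by (simp add: q_def field_simps power2_eq_square)
  \<comment> \<open>The case split also gives roots at non-vertices such as \<open>(0, 1)\<close>,
    as the root hypotheses range over all \<open>i\<close> and all \<open>j < 3\<close>.\<close>
  define l :: "nat \<times> nat \<Rightarrow> real" where "l = (\<lambda>(i, j). if j \<ge> 3 then -1
    else if i \<ge> 2 then (if j = 1 then q S else q (- S))
    else if i = 0 then r 1 else if j = 1 then r 2 else r 3)"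
  have "adjacency_spectrum vs (sunflower_edges k) = image_mset l (mset_set (sunflower_vertices k))"
  proof (rule adjacency_spectrum_eqI[OF _ assms(2,3), where f = "sunflower_eigenfunction k l"])
    show "hypergraph (sunflower_vertices k) (sunflower_edges k)"
      using uniform_hypergraph_sunflower[OF assms(1)] by (simp add: uniform_hypergraph_def)
    show "(\<Sum>e | e \<in> sunflower_edges k \<and> v \<in> e. \<Sum>u\<in>e - {v}. sunflower_eigenfunction k l w u) =
        l w * sunflower_eigenfunction k l w v"
      if "w \<in> sunflower_vertices k" "v \<in> sunflower_vertices k" for w v
      using assms(1) that
    proof (rule sunflower_eigenfunction)
      show "(l (i, j))\<^sup>2 - (real k - 3) * l (i, j) - (2 * real k - 3) = 0" if "i \<ge> 2" "j < 3" for i j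
        using that quadratic[of S] quadratic[of "- S"] by (auto simp: l_def)
      show "(l (i, j)) ^ 3 - 2 * (real k - 2) * (l (i, j))\<^sup>2 + ((real k)\<^sup>2 - 6 * real k + 6) * l (i, j)
          + (real k - 1) * (real k - 2) = 0" if "i < 2" "j < 3" for i j
        using that by (intro cubic) (auto simp: l_def)
    qed (simp add: l_def)
    show "c w = 0" if "w \<in> sunflower_vertices k"
      "\<And>v. v \<in> sunflower_vertices k \<Longrightarrow>
        (\<Sum>w\<in>sunflower_vertices k. c w * sunflower_eigenfunction k l w v) = 0" for c w
      using assms(1) _ _ _ _ that(2,1)
      by (rule sunflower_eigenfunction_independent) (use r_distinct S in \<open>auto simp: l_def q_def\<close>)
  qed
  \<comment> \<open>For \<open>k = 2\<close> the two sums contribute nothing, in agreement with the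
    multiplicities 0.\<close>
  also have "\<dots> = {#r 1#} + {#r 2#} + {#r 3#} + (\<Sum>i = 2..k - 1. {#q S#} + {#q (- S)#})
      + (\<Sum>i = 1..k - 1. \<Sum>j = 3..k. {#-1#})"
    unfolding image_mset_mset_set_eq_sum sum_sunflower_vertices[OF assms(1)]
    by (intro arg_cong2[of _ _ _ _ "(+)"] sum.cong) (auto simp: l_def)
  also have "(\<Sum>i = 1..k - 1. \<Sum>j = 3..k. {#- 1 :: real#}) = replicate_mset ((k - 1) * (k - 2)) (- 1)"
  proof -
    have "(\<Sum>i = 1..k - 1. \<Sum>j = 3..k. {#- 1 :: real#}) = (\<Sum>w\<in>{1..k - 1} \<times> {3..k}. {#- 1#})"
      by (simp add: sum.cartesian_product)
    then show ?thesis
      unfolding sum_singleton_mset_const by (simp add: card_cartesian_product)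
  qed
  also have "(\<Sum>i = 2..k - 1. {#q S#} + {#q (- S)#}) =
      replicate_mset (k - 2) (q S) + replicate_mset (k - 2) (q (- S))"
    unfolding sum.distrib sum_singleton_mset_const by (simp add: numeral_2_eq_2)
  finally show ?thesis
    by (simp add: q_def S_def ac_simps)
qed

end
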